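(* Let $C^{ijkl}$ be an elasticity tensor in three dimensions, and let $A^{ijkl}:=C^{ijkl}-C^{(ijkl)}$ and $N^{ijkl}:=C^{i[jk]l}$. Then $A$ is equivalently described by the second-rank tensor $$\Delta_{mn}:=\tfrac14\,\epsilon_{mik}\,\epsilon_{njl}\,A^{ijkl},$$ which is symmetric, $\Delta_{mn}=\Delta_{nm}$, and from which $N$ and $A$ are recovered by $$N^{ijlk}=\epsilon^{ikm}\epsilon^{jln}\Delta_{mn},\qquad A^{ijkl}=\tfrac43\cdot\tfrac12\left(\epsilon^{ikm}\epsilon^{jln}+\epsilon^{ilm}\epsilon^{jkn}\right)\Delta_{mn} .$$ (Note the index order $ijlk$ on $N$.)
   Context: Indices run over $1,2,3$; summation over repeated indices. An elasticity tensor is a real fourth-rank tensor $C^{ijkl}$ on $\mathbb R^3$ with $C^{ijkl}=C^{jikl}$, $C^{ijkl}=C^{ijlk}$ (minor symmetries) and $C^{ijkl}=C^{klij}$ (major symmetry). $C^{(ijkl)}$ is $\frac1{4!}$ times the sum over all permutations of the indices, and $C^{i[jk]l}=\frac12(C^{ijkl}-C^{ikjl})$. $\epsilon_{ijk}$ and $\epsilon^{ijk}$ are the Levi-Civita symbols, equal to $+1,-1,0$ for even, odd, and no permutations of $123$. *)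

theory Defs
  imports "HOL-Analysis.Analysis"
begin

text \<open>
  Indices live in the three-element type \<^typ>\<open>3\<close>, whose elements are \<open>1, 2, 3\<close> (with \<open>3 = 0\<close>).
  The first index of a tensor is the outermost one: \<open>C $ i $ j $ k $ l\<close> is the component
  with indices \<open>i, j, k, l\<close>. Upper and lower indices are not distinguished by the types.
\<close>

type_synonym tensor2 = "real ^ 3 ^ 3"
type_synonym tensor4 = "real ^ 3 ^ 3 ^ 3 ^ 3"

definition elasticity_tensor :: "tensor4 \<Rightarrow> bool" where
  "elasticity_tensor C \<longleftrightarrow>
     (\<forall>i j k l. C $ i $ j $ k $ l = C $ j $ i $ k $ l) \<and>
     (\<forall>i j k l. C $ i $ j $ k $ l = C $ i $ j $ l $ k) \<and>
     (\<forall>i j k l. C $ i $ j $ k $ l = C $ k $ l $ i $ j)"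

definition levi_civita :: "3 \<Rightarrow> 3 \<Rightarrow> 3 \<Rightarrow> real" where
  "levi_civita i j k =
     (let p = (\<lambda>a::3. if a = 1 then i else if a = 2 then j else k)
      in if p permutes UNIV then of_int (sign p) else 0)"

text \<open>The four index positions are numbered \<open>0, \<dots>, 3\<close>, and the sum runs over all their permutations.\<close>

definition total_sym :: "tensor4 \<Rightarrow> tensor4" where
  "total_sym C = (\<chi> i j k l. 1 / fact 4 *
     (\<Sum>p | p permutes {..<4::nat}.
        C $ ([i, j, k, l] ! p 0) $ ([i, j, k, l] ! p 1)
          $ ([i, j, k, l] ! p 2) $ ([i, j, k, l] ! p 3)))"

definition mid_antisym :: "tensor4 \<Rightarrow> tensor4" where
  "mid_antisym C = (\<chi> i j k l. 1 / 2 * (C $ i $ j $ k $ l - C $ i $ k $ j $ l))"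

definition Delta_of :: "tensor4 \<Rightarrow> tensor2" where
  "Delta_of A = (\<chi> m n. 1 / 4 *
     (\<Sum>i\<in>UNIV. \<Sum>j\<in>UNIV. \<Sum>k\<in>UNIV. \<Sum>l\<in>UNIV.
        levi_civita m i k * levi_civita n j l * A $ i $ j $ k $ l))"

end

theory Submission
  imports Defs
begin

text \<open>
  Contracting with the two \<open>\<epsilon>\<close> antisymmetrises in the first and third and in the second and fourth
  index. This kills the totally symmetric part of \<open>C\<close>, so \<open>\<Delta>\<close> may be computed from \<open>C\<close> itself, and
  dualising both indices of \<open>\<Delta>\<close> again leaves \<open>1/2 (C[ijkl] - C[iljk]) = N[ijlk]\<close>. Since the totally
  symmetric part of \<open>C\<close> is \<open>1/3 (C[ijkl] + C[ikjl] + C[iljk])\<close>, symmetrising \<open>N[ijlk]\<close> in \<open>k, l\<close> gives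
  \<open>3/4 A[ijkl]\<close>. Conversely, for symmetric \<open>\<Delta>\<close> the formula for \<open>A\<close> yields an elasticity tensor with
  vanishing totally symmetric part, so it inverts the map from \<open>A\<close> to \<open>\<Delta>\<close>.
\<close>

text \<open>Any index triple is the list of values of some \<open>q\<close>, so swapping indices
  becomes composing \<open>q\<close> with a transposition.\<close>

lemma levi_civita_function:
  fixes q :: "3 \<Rightarrow> 3"
  shows "levi_civita (q 1) (q 2) (q 3) = (if q permutes UNIV then of_int (sign q) else 0)"
proof -
  have "(\<lambda>a::3. if a = 1 then q 1 else if a = 2 then q 2 else q 3) = q"
    using exhaust_3 by (auto simp: fun_eq_iff)
  then show ?thesis
    by (simp add: levi_civita_def)
qed

lemma levi_civita_transpose:
  fixes q :: "3 \<Rightarrow> 3" and a b :: 3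
  assumes "a \<noteq> b"
  defines "t \<equiv> Transposition.transpose a b"
  shows "levi_civita (q (t 1)) (q (t 2)) (q (t 3)) = - levi_civita (q 1) (q 2) (q 3)"
proof -
  have t: "t permutes UNIV" "t \<circ> t = id" "sign t = -1"
    using assms by (simp_all add: t_def permutes_swap_id sign_swap_id)
  have iff: "(q \<circ> t) permutes UNIV \<longleftrightarrow> q permutes UNIV"
    using permutes_compose[OF t(1), of q] permutes_compose[OF t(1), of "q \<circ> t"] t(2)
    by (auto simp: comp_assoc)
  have "sign (q \<circ> t) = - sign q" if "q permutes UNIV"
    using sign_compose[of q t] that t by (auto simp: permutation_permutes)
  then show ?thesis
    using levi_civita_function[of q] levi_civita_function[of "q \<circ> t"] iff by simp
qed

lemma levi_civita_swap12: "levi_civita j i k = - levi_civita i j k"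
  using levi_civita_transpose[of 1 2 "\<lambda>a. if a = 1 then i else if a = 2 then j else k"]
  by (simp add: Transposition.transpose_def)

lemma levi_civita_swap23: "levi_civita i k j = - levi_civita i j k"
  using levi_civita_transpose[of 2 3 "\<lambda>a. if a = 1 then i else if a = 2 then j else k"]
  by (simp add: Transposition.transpose_def)

lemma levi_civita_123: "levi_civita 1 2 3 = 1"
  using levi_civita_function[of id] by simp

lemma levi_civita_eq_0 [simp]:
  "levi_civita i i k = 0" "levi_civita i k k = 0" "levi_civita i k i = 0"
  using levi_civita_swap12[of i i k] levi_civita_swap23[of i k k]
    levi_civita_swap12[of i k i] levi_civita_swap23[of k i i] by auto

lemma levi_civita_values [simp]:
  "levi_civita 1 2 3 = 1" "levi_civita 2 3 1 = 1" "levi_civita 3 1 2 = 1"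
  "levi_civita 1 3 2 = -1" "levi_civita 3 2 1 = -1" "levi_civita 2 1 3 = -1"
  by (simp_all add: levi_civita_123 levi_civita_swap23[of 1 3 2] levi_civita_swap12[of 2 1 3]
      levi_civita_swap12[of 3 1 2] levi_civita_swap23[of 2 3 1] levi_civita_swap12[of 3 2 1])

text \<open>In the index type, addition is modulo 3, so \<open>m, m + 1, m + 2\<close> is always an even permutation.\<close>

lemma numeral_mod_3 [simp]: "(4::3) = 1" "(5::3) = 2"
  by simp_all

lemma sum_levi_civita:
  fixes f :: "3 \<Rightarrow> 3 \<Rightarrow> real"
  shows "(\<Sum>i\<in>UNIV. \<Sum>k\<in>UNIV. levi_civita m i k * f i k) = f (m + 1) (m + 2) - f (m + 2) (m + 1)"
  using exhaust_3[of m] by (auto simp: sum_3)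

text \<open>The identity \<open>eps_ikm eps_mpq = delta_ip delta_kq - delta_iq delta_kp\<close>,
  with the sum over \<open>p\<close>, \<open>q\<close> already evaluated as in
  \<open>sum_levi_civita\<close>.\<close>

lemma levi_civita_contract:
  fixes f :: "3 \<Rightarrow> 3 \<Rightarrow> real"
  shows "(\<Sum>m\<in>UNIV. levi_civita i k m *
      (f (m + 1) (m + 2) - f (m + 2) (m + 1))) = f i k - f k i"
  using exhaust_3[of i] exhaust_3[of k] by (auto simp: sum_3)

lemma Delta_of_nth:
  "Delta_of A $ m $ n = 1 / 4 *
     (A $ (m + 1) $ (n + 1) $ (m + 2) $ (n + 2) - A $ (m + 2) $ (n + 1) $ (m + 1) $ (n + 2)
      - A $ (m + 1) $ (n + 2) $ (m + 2) $ (n + 1) + A $ (m + 2) $ (n + 2) $ (m + 1) $ (n + 1))"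
proof -
  have "Delta_of A $ m $ n = 1 / 4 * (\<Sum>i\<in>UNIV. \<Sum>k\<in>UNIV. levi_civita m i k *
      (\<Sum>j\<in>UNIV. \<Sum>l\<in>UNIV. levi_civita n j l * A $ i $ j $ k $ l))"
    unfolding Delta_of_def sum_distrib_left vec_lambda_beta mult.assoc
    \<comment> \<open>Exchanging the sums over \<open>j\<close> and \<open>k\<close> lets each
      symbol contract its own index pair.\<close>
    by (intro sum.cong refl sum.swap)
  then show ?thesis
    by (simp add: sum_levi_civita)
qed

text \<open>Dualises \<open>m\<close> to the pair \<open>i k\<close> and \<open>n\<close> to the
  pair \<open>j l\<close>; arguments are grouped by pair, not in tensor order.\<close>

definition hodge2 :: "tensor2 \<Rightarrow> 3 \<Rightarrow> 3 \<Rightarrow> 3 \<Rightarrow> 3 \<Rightarrow> real" where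
  "hodge2 D i k j l =
     (\<Sum>m\<in>UNIV. \<Sum>n\<in>UNIV. levi_civita i k m * levi_civita j l n * D $ m $ n)"

lemma hodge2_Delta_of:
  "hodge2 (Delta_of A) i k j l =
     1 / 4 * (A $ i $ j $ k $ l - A $ k $ j $ i $ l - A $ i $ l $ k $ j + A $ k $ l $ i $ j)"
proof -
  \<comment> \<open>What the contraction over \<open>n\<close> leaves: positions 2 and 4 are
    antisymmetrised, and \<open>p\<close>, \<open>q\<close> fill positions 1 and 3.\<close>
  define g where "g p q = 1 / 4 * (A $ p $ j $ q $ l - A $ p $ l $ q $ j)" for p q
  have "(\<Sum>n\<in>UNIV. levi_civita j l n * Delta_of A $ m $ n) =
      g (m + 1) (m + 2) - g (m + 2) (m + 1)" for m
    using levi_civita_contract[of j l "\<lambda>r s. 1 / 4 *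
        (A $ (m + 1) $ r $ (m + 2) $ s - A $ (m + 2) $ r $ (m + 1) $ s)"]
    by (simp add: Delta_of_nth g_def algebra_simps)
  then have "(\<Sum>m\<in>UNIV. levi_civita i k m * (\<Sum>n\<in>UNIV. levi_civita j l n * Delta_of A $ m $ n)) = g i k - g k i"
    by (simp add: levi_civita_contract)
  then show ?thesis
    by (simp add: hodge2_def g_def sum_distrib_left mult.assoc algebra_simps)
qed

lemma hodge2_antisym:
  "hodge2 D k i j l = - hodge2 D i k j l" "hodge2 D i k l j = - hodge2 D i k j l"
  by (simp_all add: hodge2_def levi_civita_swap12[of k i] levi_civita_swap12[of l j] sum_negf)

lemma hodge2_commute:
  assumes "\<And>m n. D $ m $ n = D $ n $ m"
  shows "hodge2 D j l i k = hodge2 D i k j l"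
  unfolding hodge2_def by (subst sum.swap) (simp add: assms mult_ac)

definition recover :: "tensor2 \<Rightarrow> tensor4" where
  "recover D = (\<chi> i j k l. 4 / 3 * (1 / 2) * (hodge2 D i k j l + hodge2 D i l j k))"

text \<open>Exchanging the two pairs gives the first minor symmetry; reversing both pairs as well,
  at the cost of two signs, gives the major one.\<close>

lemma elasticity_tensor_recover:
  assumes "\<And>m n. D $ m $ n = D $ n $ m"
  shows "elasticity_tensor (recover D)"
proof -
  have "hodge2 D k i l j = hodge2 D i k j l" for i j k l
    by (simp add: hodge2_antisym(1)[of D k i] hodge2_antisym(2)[of D i k l j])
  then show ?thesis
    unfolding elasticity_tensor_def recover_def
    by (auto simp: hodge2_commute[OF assms] add.commute)
qed

lemma Delta_of_recover:
  assumes "\<And>m n. D $ m $ n = D $ n $ m"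
  shows "Delta_of (recover D) = D"
proof -
  have "Delta_of (recover D) $ m $ n = D $ m $ n" for m n
    using exhaust_3[of m] exhaust_3[of n] assms[of 1 2] assms[of 1 3] assms[of 2 3]
    by (auto simp: Delta_of_nth recover_def hodge2_def sum_3)
  then show ?thesis
    by (simp add: vec_eq_iff)
qed

lemma elasticity_tensor_symmetries:
  assumes "elasticity_tensor C"
  shows "C $ i $ j $ k $ l = C $ j $ i $ k $ l" "C $ i $ j $ k $ l = C $ i $ j $ l $ k"
    "C $ i $ j $ k $ l = C $ k $ l $ i $ j"
  using assms unfolding elasticity_tensor_def by blast+

text \<open>The symmetries of \<open>C\<close> generate a group of order 8, so the 24 terms fall
  into three classes, told apart by the index paired with \<open>i\<close>.\<close>

lemma total_sym_nth:
  assumes "elasticity_tensor C"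
  shows "total_sym C $ i $ j $ k $ l =
    1 / 3 * (C $ i $ j $ k $ l + C $ i $ k $ j $ l + C $ i $ l $ j $ k)"
proof -
  \<comment> \<open>Nested insertions over a singleton let
    \<open>sum_over_permutations_insert\<close> peel off one position at a time.\<close>
  have set4: "{..<4::nat} = insert 0 (insert 1 (insert 2 {3}))"
    by auto
  show ?thesis
    unfolding total_sym_def set4
    by (simp add: sum_over_permutations_insert permutes_sing
        Transposition.transpose_def fact_numeral elasticity_tensor_symmetries[OF assms])
qed

text \<open>The three terms expand to six values of \<open>hodge2\<close>, which cancel in pairs by
  antisymmetry in the last two arguments.\<close>

lemma total_sym_recover:
  assumes "\<And>m n. D $ m $ n = D $ n $ m"
  shows "total_sym (recover D) = 0"
proof -
  have "total_sym (recover D) $ i $ j $ k $ l = 0" for i j k l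
    unfolding total_sym_nth[OF elasticity_tensor_recover[OF assms]]
    by (simp add: recover_def hodge2_antisym(2)[of D i j l k] hodge2_antisym(2)[of D i k l j]
        hodge2_antisym(2)[of D i l k j] field_simps)
  then show ?thesis
    by (simp add: vec_eq_iff)
qed

lemma Delta_of_minus_total_sym:
  assumes "elasticity_tensor C"
  shows "Delta_of (C - total_sym C) = Delta_of C"
  by (simp add: vec_eq_iff Delta_of_nth total_sym_nth[OF assms] elasticity_tensor_symmetries[OF assms])

lemma Delta_of_sym:
  assumes "elasticity_tensor C"
  shows "Delta_of C $ m $ n = Delta_of C $ n $ m"
  by (simp add: Delta_of_nth elasticity_tensor_symmetries[OF assms])

text \<open>Major symmetry makes the four terms of \<open>hodge2_Delta_of\<close> agree two by two,
  turning the factor 1/4 into 1/2.\<close>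

lemma mid_antisym_eq_hodge2:
  assumes "elasticity_tensor C"
  shows "mid_antisym C $ i $ j $ l $ k = hodge2 (Delta_of C) i k j l"
  by (simp add: mid_antisym_def hodge2_Delta_of elasticity_tensor_symmetries[OF assms])

lemma recover_Delta_of:
  assumes "elasticity_tensor C"
  shows "recover (Delta_of C) = C - total_sym C"
  by (simp add: vec_eq_iff recover_def hodge2_Delta_of total_sym_nth[OF assms]
      elasticity_tensor_symmetries[OF assms] field_simps)

theorem proposition10:
  fixes C A N :: tensor4 and \<Delta> :: tensor2
  assumes "elasticity_tensor C"
    and "A = C - total_sym C"
    and "N = mid_antisym C"
    and "\<Delta> = Delta_of A"
  shows "bij_betw Delta_of {C' - total_sym C' | C'. elasticity_tensor C'}
           {D :: tensor2. \<forall>m n. D $ m $ n = D $ n $ m} \<and>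
         (\<forall>m n. \<Delta> $ m $ n = \<Delta> $ n $ m) \<and>
         (\<forall>i j k l. N $ i $ j $ l $ k =
           (\<Sum>m\<in>UNIV. \<Sum>n\<in>UNIV. levi_civita i k m * levi_civita j l n * \<Delta> $ m $ n)) \<and>
         (\<forall>i j k l. A $ i $ j $ k $ l = 4 / 3 * (1 / 2) *
           (\<Sum>m\<in>UNIV. \<Sum>n\<in>UNIV.
              (levi_civita i k m * levi_civita j l n + levi_civita i l m * levi_civita j k n)
              * \<Delta> $ m $ n))"
proof (intro conjI allI)
  have \<Delta>: "\<Delta> = Delta_of C"
    using assms by (simp add: Delta_of_minus_total_sym)
  show "\<Delta> $ m $ n = \<Delta> $ n $ m" for m n
    unfolding \<Delta> by (rule Delta_of_sym[OF assms(1)])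
  show "N $ i $ j $ l $ k =
      (\<Sum>m\<in>UNIV. \<Sum>n\<in>UNIV. levi_civita i k m * levi_civita j l n * \<Delta> $ m $ n)" for i j k l
    unfolding assms(3) \<Delta> mid_antisym_eq_hodge2[OF assms(1)] hodge2_def ..
  have "A = recover \<Delta>"
    by (simp add: assms(2) \<Delta> recover_Delta_of[OF assms(1)])
  then show "A $ i $ j $ k $ l = 4 / 3 * (1 / 2) *
      (\<Sum>m\<in>UNIV. \<Sum>n\<in>UNIV.
         (levi_civita i k m * levi_civita j l n + levi_civita i l m * levi_civita j k n)
         * \<Delta> $ m $ n)" for i j k l
    by (simp add: recover_def hodge2_def distrib_right sum.distrib)
  show "bij_betw Delta_of {C' - total_sym C' | C'. elasticity_tensor C'}
      {D :: tensor2. \<forall>m n. D $ m $ n = D $ n $ m}"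
  proof (rule bij_betw_byWitness[where f' = recover])
    show "\<forall>A\<in>{C' - total_sym C' | C'. elasticity_tensor C'}. recover (Delta_of A) = A"
      by (auto simp: Delta_of_minus_total_sym recover_Delta_of)
    show "\<forall>D\<in>{D. \<forall>m n. D $ m $ n = D $ n $ m}. Delta_of (recover D) = D"
      by (simp add: Delta_of_recover)
    show "Delta_of ` {C' - total_sym C' | C'. elasticity_tensor C'}
        \<subseteq> {D. \<forall>m n. D $ m $ n = D $ n $ m}"
      using Delta_of_sym by (auto simp: Delta_of_minus_total_sym)
    \<comment> \<open>The witness for \<open>C'\<close> is \<open>recover D\<close> itself.\<close>
    have "recover D = recover D - total_sym (recover D)" if "\<forall>m n. D $ m $ n = D $ n $ m" for D
      using that by (simp add: total_sym_recover)
    then show "recover ` {D. \<forall>m n. D $ m $ n = D $ n $ m}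
        \<subseteq> {C' - total_sym C' | C'. elasticity_tensor C'}"
      using elasticity_tensor_recover by blast
  qed
qed

end
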